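(* Let $K$ be a field and $X$ a non-empty finite set. There is a countable associative algebra (ring) $B$ which is not residually nilpotent and is elementarily equivalent to $\mathbb{A}^0_K(X)$.
   Context: $\mathbb{A}^0_K(X)$ denotes the free associative algebra without unity over $K$ with basis $X$, viewed in the language of rings $\{+,\cdot,0\}$. For a ring $A$, $A^n$ is the additive subgroup generated by all products $a_1\cdots a_n$, $a_i\in A$; $A$ is residually nilpotent if $\bigcap_{n\ge1}A^n=0$. *)

theory Defs
  imports "HOL-Algebra.Module" "HOL-Algebra.Generated_Groups" "HOL-Library.Countable_Set"
begin

section \<open>Associative rings and algebras without unity\<close>

text \<open>
  HOL-Algebra has no rings without unity.  We reuse its records, so that its additive theory
  (\<^locale>\<open>abelian_group\<close>, \<^locale>\<open>module\<close>) applies; the field \<^const>\<open>one\<close> of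
  these records is never read for the rings without unity considered here and may be anything.
\<close>

locale nonunital_ring = abelian_group R for R (structure) +
  assumes m_closed: "\<lbrakk>x \<in> carrier R; y \<in> carrier R\<rbrakk> \<Longrightarrow> x \<otimes> y \<in> carrier R"
    and m_assoc: "\<lbrakk>x \<in> carrier R; y \<in> carrier R; z \<in> carrier R\<rbrakk>
      \<Longrightarrow> (x \<otimes> y) \<otimes> z = x \<otimes> (y \<otimes> z)"
    and l_distr: "\<lbrakk>x \<in> carrier R; y \<in> carrier R; z \<in> carrier R\<rbrakk>
      \<Longrightarrow> (x \<oplus> y) \<otimes> z = x \<otimes> z \<oplus> y \<otimes> z"
    and r_distr: "\<lbrakk>x \<in> carrier R; y \<in> carrier R; z \<in> carrier R\<rbrakk>
      \<Longrightarrow> z \<otimes> (x \<oplus> y) = z \<otimes> x \<oplus> z \<otimes> y"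

locale nonunital_algebra = module K A + nonunital_ring A for K (structure) and A (structure) +
  assumes smult_m_left: "\<lbrakk>c \<in> carrier K; x \<in> carrier A; y \<in> carrier A\<rbrakk>
      \<Longrightarrow> (c \<odot>\<^bsub>A\<^esub> x) \<otimes>\<^bsub>A\<^esub> y = c \<odot>\<^bsub>A\<^esub> (x \<otimes>\<^bsub>A\<^esub> y)"
    and smult_m_right: "\<lbrakk>c \<in> carrier K; x \<in> carrier A; y \<in> carrier A\<rbrakk>
      \<Longrightarrow> x \<otimes>\<^bsub>A\<^esub> (c \<odot>\<^bsub>A\<^esub> y) = c \<odot>\<^bsub>A\<^esub> (x \<otimes>\<^bsub>A\<^esub> y)"

section \<open>The free associative algebra without unity\<close>

text \<open>
  The monomials are the nonempty words over \<open>X\<close>, multiplied by concatenation.  An element is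
  the function giving the coefficient of each word: finitely supported, and zero on every list
  that is not a nonempty word over \<open>X\<close>.
\<close>

definition free_nonunital_algebra ::
  "('k, 'm) ring_scheme \<Rightarrow> 'x set \<Rightarrow> ('k, 'x list \<Rightarrow> 'k) module"
  where "free_nonunital_algebra K X =
    \<lparr>carrier = {f. (\<forall>w. f w \<in> carrier K) \<and> finite {w. f w \<noteq> \<zero>\<^bsub>K\<^esub>} \<and>
                  (\<forall>w. f w \<noteq> \<zero>\<^bsub>K\<^esub> \<longrightarrow> w \<noteq> [] \<and> set w \<subseteq> X)},
     mult = (\<lambda>f g w. \<Oplus>\<^bsub>K\<^esub>i\<in>{..length w}. f (take i w) \<otimes>\<^bsub>K\<^esub> g (drop i w)),
     one = undefined,
     zero = (\<lambda>w. \<zero>\<^bsub>K\<^esub>),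
     add = (\<lambda>f g w. f w \<oplus>\<^bsub>K\<^esub> g w),
     smult = (\<lambda>c f w. c \<otimes>\<^bsub>K\<^esub> f w)\<rparr>"

section \<open>Residual nilpotence\<close>

definition products_of :: "('a, 'm) ring_scheme \<Rightarrow> nat \<Rightarrow> 'a set"
  where "products_of A n =
    {foldl (mult A) a as |a as. a \<in> carrier A \<and> set as \<subseteq> carrier A \<and> Suc (length as) = n}"

definition ring_power :: "('a, 'm) ring_scheme \<Rightarrow> nat \<Rightarrow> 'a set"
  where "ring_power A n = generate (add_monoid A) (products_of A n)"

definition residually_nilpotent :: "('a, 'm) ring_scheme \<Rightarrow> bool"
  where "residually_nilpotent A \<longleftrightarrow> (\<Inter>n\<in>{1..}. ring_power A n) = {\<zero>\<^bsub>A\<^esub>}"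

section \<open>First-order logic in the language of rings without unity\<close>

datatype rterm = TVar nat | TZero | TAdd rterm rterm | TMul rterm rterm

datatype rformula =
    FEq rterm rterm
  | FNeg rformula
  | FConj rformula rformula
  | FExists nat rformula

fun term_vars :: "rterm \<Rightarrow> nat set" where
  "term_vars (TVar i) = {i}"
| "term_vars TZero = {}"
| "term_vars (TAdd s t) = term_vars s \<union> term_vars t"
| "term_vars (TMul s t) = term_vars s \<union> term_vars t"

fun free_vars :: "rformula \<Rightarrow> nat set" where
  "free_vars (FEq s t) = term_vars s \<union> term_vars t"
| "free_vars (FNeg \<phi>) = free_vars \<phi>"
| "free_vars (FConj \<phi> \<psi>) = free_vars \<phi> \<union> free_vars \<psi>"
| "free_vars (FExists i \<phi>) = free_vars \<phi> - {i}"

definition is_sentence :: "rformula \<Rightarrow> bool"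
  where "is_sentence \<phi> \<longleftrightarrow> free_vars \<phi> = {}"

fun term_val :: "('a, 'm) ring_scheme \<Rightarrow> (nat \<Rightarrow> 'a) \<Rightarrow> rterm \<Rightarrow> 'a" where
  "term_val A e (TVar i) = e i"
| "term_val A e TZero = \<zero>\<^bsub>A\<^esub>"
| "term_val A e (TAdd s t) = term_val A e s \<oplus>\<^bsub>A\<^esub> term_val A e t"
| "term_val A e (TMul s t) = term_val A e s \<otimes>\<^bsub>A\<^esub> term_val A e t"

fun satisfies :: "('a, 'm) ring_scheme \<Rightarrow> (nat \<Rightarrow> 'a) \<Rightarrow> rformula \<Rightarrow> bool" where
  "satisfies A e (FEq s t) \<longleftrightarrow> term_val A e s = term_val A e t"
| "satisfies A e (FNeg \<phi>) \<longleftrightarrow> \<not> satisfies A e \<phi>"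
| "satisfies A e (FConj \<phi> \<psi>) \<longleftrightarrow> satisfies A e \<phi> \<and> satisfies A e \<psi>"
| "satisfies A e (FExists i \<phi>) \<longleftrightarrow> (\<exists>a\<in>carrier A. satisfies A (e(i := a)) \<phi>)"

definition models :: "('a, 'm) ring_scheme \<Rightarrow> rformula \<Rightarrow> bool"
  where "models A \<phi> \<longleftrightarrow> (\<forall>e. range e \<subseteq> carrier A \<longrightarrow> satisfies A e \<phi>)"

definition elementarily_equivalent ::
  "('a, 'm) ring_scheme \<Rightarrow> ('b, 'n) ring_scheme \<Rightarrow> bool"
  where "elementarily_equivalent A B \<longleftrightarrow> (\<forall>\<phi>. is_sentence \<phi> \<longrightarrow> (models A \<phi> \<longleftrightarrow> models B \<phi>))"

end

(*
  Let A be the free algebra, x a generator, and let U be a nonprincipal ultrafilter on the natural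
  numbers.  In the ultrapower of A modulo U, the class b of the sequence x, x^2, x^3, ... is nonzero,
  and for every n it is a product of n elements: the class of the shifted sequence x^(max(i-n+2,1)),
  followed by n - 1 factors x.  As in the downward Loewenheim-Skolem theorem, take a countable set D of
  sequences in A that contains the sequences used in these factorisations and is closed under the ring
  operations, under scalars from a countable subfield of K, and under pointwise Skolem functions.  By
  the argument of Los's theorem, D modulo U is elementarily equivalent to A, and it still contains b.
*)

theory Submission
  imports Defs "HOL-Algebra.Weak_Morphisms" "HOL-Algebra.Subrings"
begin

section \<open>Ultrafilters and countable closures\<close>

text \<open>Zorn's lemma for proper filters below \<open>F\<close>. A minimal one decides every
  \<open>P\<close>: if the negation of \<open>P\<close> is not eventual, adjoining \<open>P\<close>
  keeps the filter proper, so minimality forces it to contain \<open>P\<close> already.\<close>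

lemma ultrafilter_below:
  fixes F :: "'i filter"
  assumes "F \<noteq> bot"
  shows "\<exists>U\<le>F. U \<noteq> bot \<and> (\<forall>P. eventually P U \<or> eventually (\<lambda>i. \<not> P i) U)"
proof -
  define \<A> where "\<A> = {G. G \<noteq> bot \<and> G \<le> F}"
  \<comment> \<open>The order is reversed so that the maximal elements produced by Zorn's lemma are
    the finest filters.\<close>
  let ?R = "relation_of (\<lambda>G H :: 'i filter. H \<le> G) \<A>"
  have "\<exists>U\<in>\<A>. \<forall>G\<in>\<A>. G \<le> U \<longrightarrow> G = U"
  proof (rule predicate_Zorn)
    show "partial_order_on \<A> ?R"
      by (rule partial_order_on_relation_ofI) auto
  next
    fix \<C> assume "\<C> \<in> Chains ?R"
    then have sub: "\<C> \<subseteq> \<A>" and chain: "\<And>G H. G \<in> \<C> \<Longrightarrow> H \<in> \<C> \<Longrightarrow> G \<le> H \<or> H \<le> G"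
      by (auto simp: Chains_def relation_of_def)
    \<comment> \<open>Inserting \<open>F\<close> also bounds the empty chain. Since the family is
      directed, its infimum could only be improper if some member were.\<close>
    have "eventually P (Inf (insert F \<C>)) \<longleftrightarrow> (\<exists>G\<in>insert F \<C>. eventually P G)" for P
    proof (rule eventually_Inf_base)
      fix G H assume "G \<in> insert F \<C>" "H \<in> insert F \<C>"
      moreover from this have "G \<le> H \<or> H \<le> G"
        using sub chain by (auto simp: \<A>_def)
      ultimately show "\<exists>x\<in>insert F \<C>. x \<le> inf G H"
        by auto
    qed simp
    then have "Inf (insert F \<C>) \<noteq> bot"
      using sub assms by (auto simp: trivial_limit_def \<A>_def)
    then have "Inf (insert F \<C>) \<in> \<A>"
      by (auto simp: \<A>_def)
    moreover have "\<forall>G\<in>\<C>. Inf (insert F \<C>) \<le> G"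
      by (intro ballI Inf_lower) simp
    ultimately show "\<exists>u\<in>\<A>. \<forall>G\<in>\<C>. u \<le> G" ..
  qed
  then obtain U where U: "U \<in> \<A>" and min: "\<And>G. G \<in> \<A> \<Longrightarrow> G \<le> U \<Longrightarrow> G = U"
    by blast
  have "eventually P U" if "\<not> eventually (\<lambda>i. \<not> P i) U" for P
  proof -
    let ?G = "inf U (principal {i. P i})"
    have "?G \<noteq> bot"
      using that by (simp add: trivial_limit_def eventually_inf_principal)
    then have "?G = U"
      using U by (intro min) (auto simp: \<A>_def intro: le_infI1)
    moreover have "eventually P ?G"
      by (simp add: eventually_inf_principal)
    ultimately show ?thesis by simp
  qed
  then show ?thesis
    using U by (auto simp: \<A>_def)
qed

text \<open>Starting from the empty set, the operations are applied in countably many rounds.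
  Arguments are finite lists, so a list over the union already lies in one stage. Taking lists of
  any length treats constants and operations of all arities alike; the empty list sets the iteration
  going.\<close>

lemma countable_closure:
  assumes "countable F" and closed: "\<And>f xs. f \<in> F \<Longrightarrow> set xs \<subseteq> M \<Longrightarrow> f xs \<in> M"
  shows "\<exists>D. countable D \<and> D \<subseteq> M \<and> (\<forall>f\<in>F. \<forall>xs. set xs \<subseteq> D \<longrightarrow> f xs \<in> D)"
proof -
  define step where "step S = S \<union> (\<lambda>(f, xs). f xs) ` (F \<times> lists S)" for S
  define S where "S n = (step ^^ n) {}" for n
  have S_Suc: "S (Suc n) = step (S n)" for n
    by (simp add: S_def)
  have "S n \<subseteq> S (Suc n)" for n
    by (auto simp: S_Suc step_def)
  then have mono: "S m \<subseteq> S n" if "m \<le> n" for m n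
    using that by (rule lift_Suc_mono_le)
  have "countable (S n)" for n
  proof (induction n)
    case (Suc n)
    then show ?case
      using \<open>countable F\<close> by (simp add: S_Suc step_def)
  qed (simp add: S_def)
  then have "countable (\<Union>n. S n)" by simp
  moreover have "S n \<subseteq> M" for n
  proof (induction n)
    case (Suc n)
    then show ?case
      unfolding S_Suc step_def using closed by (auto simp: in_lists_conv_set subset_iff)
  qed (simp add: S_def)
  then have "(\<Union>n. S n) \<subseteq> M" by blast
  moreover have "f xs \<in> (\<Union>n. S n)" if f: "f \<in> F" and xs: "set xs \<subseteq> (\<Union>n. S n)" for f xs
  proof -
    from xs have "\<exists>n. set xs \<subseteq> S n"
    proof (induction xs)
      case (Cons x xs)
      then obtain m n where "x \<in> S m" "set xs \<subseteq> S n" by auto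
      with mono[of m "max m n"] mono[of n "max m n"] have "set (x # xs) \<subseteq> S (max m n)"
        by auto
      then show ?case ..
    qed simp
    then obtain n where "set xs \<subseteq> S n" ..
    with f have "f xs \<in> S (Suc n)"
      by (auto simp: S_Suc step_def in_lists_conv_set intro!: rev_image_eqI[of "(f, xs)"])
    then show ?thesis by blast
  qed
  ultimately show ?thesis
    by (intro exI[of _ "\<Union>n. S n"] conjI ballI allI impI)
qed

text \<open>\<open>K\<close> may be uncountable, in which case a countable nonzero algebra can only
  have scalars from a smaller field. This one is the closure of \<open>\<one>\<close> under the
  field operations.\<close>

lemma (in field) countable_subfield_exists:
  obtains K where "subfield K R" "countable K"
proof -
  \<comment> \<open>Lists of the wrong length, and the inverse of zero, give the default
    \<open>\<one>\<close>, so every operation stays inside the carrier.\<close>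
  define F where "F = {\<lambda>_. \<one>,
    \<lambda>xs. case xs of [x, y] \<Rightarrow> x \<oplus> y | _ \<Rightarrow> \<one>,
    \<lambda>xs. case xs of [x, y] \<Rightarrow> x \<otimes> y | _ \<Rightarrow> \<one>,
    \<lambda>xs. case xs of [x] \<Rightarrow> \<ominus> x | _ \<Rightarrow> \<one>,
    \<lambda>xs. case xs of [x] \<Rightarrow> if x = \<zero> then \<one> else inv x | _ \<Rightarrow> \<one>}"
  have "countable F" by (simp add: F_def)
  moreover have "f xs \<in> carrier R" if "f \<in> F" "set xs \<subseteq> carrier R" for f xs
    using that by (auto simp: F_def field_Units split: list.splits)
  ultimately have "\<exists>K. countable K \<and> K \<subseteq> carrier R \<and> (\<forall>f\<in>F. \<forall>xs. set xs \<subseteq> K \<longrightarrow> f xs \<in> K)"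
    by (rule countable_closure)
  then obtain K where "countable K" and sub: "K \<subseteq> carrier R"
    and "\<forall>f\<in>F. \<forall>xs. set xs \<subseteq> K \<longrightarrow> f xs \<in> K"
    by (elim exE conjE)
  then have closed: "f xs \<in> K" if "f \<in> F" "set xs \<subseteq> K" for f xs
    using that by blast
  have K_one: "\<one> \<in> K"
    using closed[of "\<lambda>_. \<one>" "[]"] by (simp add: F_def)
  have K_add: "x \<oplus> y \<in> K" if "x \<in> K" "y \<in> K" for x y
    using closed[of "\<lambda>xs. case xs of [x, y] \<Rightarrow> x \<oplus> y | _ \<Rightarrow> \<one>" "[x, y]"] that by (simp add: F_def)
  have K_mult: "x \<otimes> y \<in> K" if "x \<in> K" "y \<in> K" for x y
    using closed[of "\<lambda>xs. case xs of [x, y] \<Rightarrow> x \<otimes> y | _ \<Rightarrow> \<one>" "[x, y]"] that by (simp add: F_def)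
  have K_neg: "\<ominus> x \<in> K" if "x \<in> K" for x
    using closed[of "\<lambda>xs. case xs of [x] \<Rightarrow> \<ominus> x | _ \<Rightarrow> \<one>" "[x]"] that by (simp add: F_def)
  have K_inv: "inv x \<in> K" if "x \<in> K" "x \<noteq> \<zero>" for x
    using closed[of "\<lambda>xs. case xs of [x] \<Rightarrow> if x = \<zero> then \<one> else inv x | _ \<Rightarrow> \<one>" "[x]"] that
    by (simp add: F_def)
  have "subring K R"
    by (rule subringI) (use sub K_one K_add K_mult K_neg in auto)
  then have "subfield K R"
    by (rule subfieldI') (use K_inv in auto)
  with \<open>countable K\<close> show ?thesis by (rule that[rotated])
qed

section \<open>Terms and formulas\<close>

instance rterm :: countable
  by countable_datatype

text \<open>Each formula and variable will contribute one Skolem function; countable syntax keeps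
  their number countable.\<close>

instance rformula :: countable
  by countable_datatype

lemma finite_term_vars: "finite (term_vars t)"
  by (induction t) auto

lemma finite_free_vars: "finite (free_vars \<phi>)"
  by (induction \<phi>) (auto simp: finite_term_vars)

lemma term_val_cong: "(\<And>j. j \<in> term_vars t \<Longrightarrow> e j = e' j) \<Longrightarrow> term_val A e t = term_val A e' t"
  by (induction t) simp_all

lemma satisfies_cong:
  "(\<And>j. j \<in> free_vars \<phi> \<Longrightarrow> e j = e' j) \<Longrightarrow> satisfies A e \<phi> \<longleftrightarrow> satisfies A e' \<phi>"
proof (induction \<phi> arbitrary: e e')
  case (FEq s t)
  then show ?case
    using term_val_cong[of s e e' A] term_val_cong[of t e e' A] by simp
next
  case (FNeg \<phi>)
  have "satisfies A e \<phi> \<longleftrightarrow> satisfies A e' \<phi>"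
    using FNeg.prems by (intro FNeg.IH) auto
  then show ?case by simp
next
  case (FConj \<phi> \<psi>)
  have "satisfies A e \<phi> \<longleftrightarrow> satisfies A e' \<phi>"
    using FConj.prems by (intro FConj.IH(1)) auto
  moreover have "satisfies A e \<psi> \<longleftrightarrow> satisfies A e' \<psi>"
    using FConj.prems by (intro FConj.IH(2)) auto
  ultimately show ?case by simp
next
  case (FExists i \<phi>)
  have "satisfies A (e(i := a)) \<phi> \<longleftrightarrow> satisfies A (e'(i := a)) \<phi>" for a
    using FExists.prems by (intro FExists.IH) auto
  then show ?case by simp
qed

text \<open>All assignments agree on the empty set of free variables. Hence truth of a sentence can
  be tested at one constant assignment.\<close>

lemma models_sentence_iff:
  assumes "is_sentence \<phi>" and "range e \<subseteq> carrier A"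
  shows "models A \<phi> \<longleftrightarrow> satisfies A e \<phi>"
  using assms satisfies_cong[of \<phi> _ e A] unfolding models_def is_sentence_def by blast

section \<open>Countable pieces of ultrapowers\<close>

text \<open>
  The quotient of \<open>D\<close> by equality \<open>U\<close>-almost everywhere is encoded by any map \<open>h\<close> whose fibres are
  its classes, so that it can be realised on the natural numbers.
\<close>
locale ultrapower_image =
  nonunital_ring A for A :: "('a, 'm) ring_scheme" (structure) and U :: "'i filter" and D :: "('i \<Rightarrow> 'a) set"
    and h :: "('i \<Rightarrow> 'a) \<Rightarrow> 'b" and B :: "('b, 'n) ring_scheme" +
  assumes U_proper: "U \<noteq> bot"
    and U_ultra: "eventually P U \<or> eventually (\<lambda>i. \<not> P i) U"
    and D_carrier: "f \<in> D \<Longrightarrow> f i \<in> carrier A"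
    and D_zero: "(\<lambda>_. \<zero>) \<in> D"
    and D_add: "\<lbrakk>f \<in> D; g \<in> D\<rbrakk> \<Longrightarrow> (\<lambda>i. f i \<oplus> g i) \<in> D"
    and D_minus: "f \<in> D \<Longrightarrow> (\<lambda>i. \<ominus> f i) \<in> D"
    and D_mult: "\<lbrakk>f \<in> D; g \<in> D\<rbrakk> \<Longrightarrow> (\<lambda>i. f i \<otimes> g i) \<in> D"
    and h_eq_iff: "\<lbrakk>f \<in> D; g \<in> D\<rbrakk> \<Longrightarrow> h f = h g \<longleftrightarrow> (\<forall>\<^sub>F i in U. f i = g i)"
    and B_carrier: "carrier B = h ` D"
    and B_zero: "\<zero>\<^bsub>B\<^esub> = h (\<lambda>_. \<zero>)"
    and B_add: "\<lbrakk>f \<in> D; g \<in> D\<rbrakk> \<Longrightarrow> h f \<oplus>\<^bsub>B\<^esub> h g = h (\<lambda>i. f i \<oplus> g i)"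
    and B_mult: "\<lbrakk>f \<in> D; g \<in> D\<rbrakk> \<Longrightarrow> h f \<otimes>\<^bsub>B\<^esub> h g = h (\<lambda>i. f i \<otimes> g i)"
begin

text \<open>The axioms hold at every index in \<open>A\<close>, so both sides of each are
  \<open>h\<close> of the same sequence.\<close>

lemma nonunital_ring_B: "nonunital_ring B"
proof -
  have "abelian_group B"
  proof (rule abelian_groupI)
    fix x assume "x \<in> carrier B"
    then obtain f where "f \<in> D" "x = h f"
      by (auto simp: B_carrier)
    then have "h (\<lambda>i. \<ominus> f i) \<in> carrier B" "h (\<lambda>i. \<ominus> f i) \<oplus>\<^bsub>B\<^esub> x = \<zero>\<^bsub>B\<^esub>"
      by (simp_all add: B_carrier B_zero B_add D_minus D_carrier l_neg)
    then show "\<exists>y\<in>carrier B. y \<oplus>\<^bsub>B\<^esub> x = \<zero>\<^bsub>B\<^esub>" ..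
  next
    fix x y assume "x \<in> carrier B" "y \<in> carrier B"
    then obtain f g where "f \<in> D" "x = h f" "g \<in> D" "y = h g"
      by (auto simp: B_carrier)
    then show "x \<oplus>\<^bsub>B\<^esub> y = y \<oplus>\<^bsub>B\<^esub> x"
      by (simp add: B_add a_comm[OF D_carrier D_carrier, of f g])
  qed (auto simp: B_carrier B_zero B_add D_zero D_add D_carrier a_assoc)
  moreover have "nonunital_ring_axioms B"
    by unfold_locales (auto simp: B_carrier B_add B_mult D_add D_mult D_carrier m_assoc l_distr r_distr)
  ultimately show ?thesis
    by (simp add: nonunital_ring_def)
qed

text \<open>Membership in \<open>D\<close> is proved in the same induction because the rules for the
  operations of \<open>B\<close> apply only to images of members of \<open>D\<close>.\<close>

lemma term_val_h:
  assumes "\<And>j. e j \<in> D"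
  shows "(\<lambda>i. term_val A (\<lambda>j. e j i) t) \<in> D
    \<and> term_val B (\<lambda>j. h (e j)) t = h (\<lambda>i. term_val A (\<lambda>j. e j i) t)"
  by (induction t) (auto simp: assms D_zero D_add D_mult B_zero B_add B_mult)

text \<open>Los's theorem for a subset of the ultrapower. In the full ultrapower witnesses are
  chosen freely at each index; here the hypothesis on witnesses guarantees that such a choice can be
  made inside \<open>D\<close>.\<close>

theorem satisfies_iff_eventually:
  assumes witness: "\<And>\<phi> j e. \<forall>k. e k \<in> D \<Longrightarrow> \<exists>w\<in>D. \<forall>i.
      (\<exists>a\<in>carrier A. satisfies A ((\<lambda>k. e k i)(j := a)) \<phi>)
      \<longrightarrow> satisfies A ((\<lambda>k. e k i)(j := w i)) \<phi>"
    and "\<And>k. e k \<in> D"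
  shows "satisfies B (\<lambda>k. h (e k)) \<phi> \<longleftrightarrow> (\<forall>\<^sub>F i in U. satisfies A (\<lambda>k. e k i) \<phi>)"
  using assms(2)
proof (induction \<phi> arbitrary: e)
  case (FEq s t)
  then show ?case
    using term_val_h[of e s] term_val_h[of e t] by (simp add: h_eq_iff)
next
  case (FNeg \<phi>)
  \<comment> \<open>Negation is the case that requires an ultrafilter: one direction is its decision
    property, the other its properness.\<close>
  have "(\<not> (\<forall>\<^sub>F i in U. satisfies A (\<lambda>k. e k i) \<phi>))
    \<longleftrightarrow> (\<forall>\<^sub>F i in U. \<not> satisfies A (\<lambda>k. e k i) \<phi>)" (is "?l \<longleftrightarrow> ?r")
  proof
    assume ?l then show ?r
      using U_ultra by blast
  next
    assume r: ?r
    show ?l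
    proof
      assume "\<forall>\<^sub>F i in U. satisfies A (\<lambda>k. e k i) \<phi>"
      with r have "\<forall>\<^sub>F i in U. False"
        by eventually_elim simp
      with U_proper show False
        by (simp add: trivial_limit_def)
    qed
  qed
  then show ?case
    using FNeg by simp
next
  case (FConj \<phi> \<psi>)
  then show ?case
    by (simp add: eventually_conj_iff)
next
  case (FExists j \<phi>)
  let ?s = "\<lambda>f i. satisfies A ((\<lambda>k. e k i)(j := f i)) \<phi>"
  have IH: "satisfies B ((\<lambda>k. h (e k))(j := h f)) \<phi> \<longleftrightarrow> (\<forall>\<^sub>F i in U. ?s f i)" if "f \<in> D" for f
  proof -
    have "(\<lambda>k. h ((e(j := f)) k)) = (\<lambda>k. h (e k))(j := h f)"
      "\<And>i. (\<lambda>k. (e(j := f)) k i) = (\<lambda>k. e k i)(j := f i)"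
      by auto
    moreover have "\<And>k. (e(j := f)) k \<in> D"
      using that FExists.prems by simp
    ultimately show ?thesis
      using FExists.IH[of "e(j := f)"] by simp
  qed
  \<comment> \<open>One sequence \<open>w\<close> is a witness at every index that has one, which
    turns eventual existence into a single element of \<open>B\<close>.\<close>
  obtain w where w: "w \<in> D"
    "\<And>i a. a \<in> carrier A \<Longrightarrow> ?s (\<lambda>_. a) i \<Longrightarrow> ?s w i"
    using witness[of e j \<phi>] FExists.prems by blast
  have "satisfies B (\<lambda>k. h (e k)) (FExists j \<phi>) \<longleftrightarrow> (\<exists>f\<in>D. \<forall>\<^sub>F i in U. ?s f i)"
    by (simp add: B_carrier IH)
  also have "\<dots> \<longleftrightarrow> (\<forall>\<^sub>F i in U. \<exists>a\<in>carrier A. ?s (\<lambda>_. a) i)" (is "?l \<longleftrightarrow> ?r")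
  proof
    assume ?l
    then obtain f where "f \<in> D" "\<forall>\<^sub>F i in U. ?s f i" by blast
    from this(2) show ?r
      by eventually_elim (use D_carrier[OF \<open>f \<in> D\<close>] in blast)
  next
    assume ?r
    then have "\<forall>\<^sub>F i in U. ?s w i"
      by eventually_elim (use w(2) in blast)
    with w(1) show ?l by blast
  qed
  finally show ?case by simp
qed

end

text \<open>Scalars act through \<sigma>, so \<open>L\<close> may be a renamed copy of a small
  subfield, and \<open>D\<close> need only be closed under scalars from the image of \<sigma>. The
  axioms again hold at each index.\<close>

lemma nonunital_algebra_ultrapower_image:
  fixes A :: "('k, 'a, 'm) module_scheme" and B :: "('l, 'b, 'n) module_scheme"
  assumes "ultrapower_image A U D h B" and "nonunital_algebra K A"
    and "cring L" and \<sigma>: "\<sigma> \<in> ring_hom L K"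
    and D_smult: "\<And>c f. \<lbrakk>c \<in> carrier L; f \<in> D\<rbrakk> \<Longrightarrow> (\<lambda>i. \<sigma> c \<odot>\<^bsub>A\<^esub> f i) \<in> D"
    and B_smult: "\<And>c f. \<lbrakk>c \<in> carrier L; f \<in> D\<rbrakk> \<Longrightarrow> c \<odot>\<^bsub>B\<^esub> h f = h (\<lambda>i. \<sigma> c \<odot>\<^bsub>A\<^esub> f i)"
  shows "nonunital_algebra L B"
proof -
  interpret ultrapower_image A U D h B by fact
  interpret A: nonunital_algebra K A by fact
  interpret L: cring L by fact
  interpret B: nonunital_ring B by (rule nonunital_ring_B)
  note simps = B_carrier B_add B_mult B_smult D_smult D_add D_mult D_carrier
    ring_hom_closed[OF \<sigma>] ring_hom_add[OF \<sigma>] ring_hom_mult[OF \<sigma>] ring_hom_one[OF \<sigma>]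
    A.smult_l_distr A.smult_r_distr A.smult_assoc1 A.smult_m_left A.smult_m_right
  have "Module.module L B"
    by (rule moduleI[OF \<open>cring L\<close> B.abelian_group_axioms]) (auto simp: simps)
  moreover have "nonunital_algebra_axioms L B"
    by unfold_locales (auto simp: simps)
  ultimately show ?thesis
    by (simp add: nonunital_algebra_def B.nonunital_ring_axioms)
qed

section \<open>The free algebra as an algebra\<close>

text \<open>Both sides run over the pairs with \<open>j \<le> i \<le> n\<close>; on the right the
  second index is measured from \<open>j\<close>.\<close>

lemma (in abelian_monoid) finsum_triangle:
  fixes F :: "nat \<Rightarrow> nat \<Rightarrow> 'a"
  assumes "\<And>j i. F j i \<in> carrier G"
  shows "(\<Oplus>i\<in>{..n}. \<Oplus>j\<in>{..i}. F j i) = (\<Oplus>j\<in>{..n}. \<Oplus>i\<in>{..n - j}. F j (j + i))"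
proof (induction n)
  case 0
  then show ?case using assms by simp
next
  case (Suc n)
  have "(\<Oplus>j\<in>{..Suc n}. \<Oplus>i\<in>{..Suc n - j}. F j (j + i))
      = F (Suc n) (Suc n) \<oplus> (\<Oplus>j\<in>{..n}. \<Oplus>i\<in>{..Suc n - j}. F j (j + i))"
    using assms by simp
  \<comment> \<open>Each inner sum gains just its last term, where \<open>j + i\<close> equals
    \<open>Suc n\<close>.\<close>
  also have "(\<Oplus>j\<in>{..n}. \<Oplus>i\<in>{..Suc n - j}. F j (j + i))
      = (\<Oplus>j\<in>{..n}. F j (Suc n) \<oplus> (\<Oplus>i\<in>{..n - j}. F j (j + i)))"
    by (rule finsum_cong') (use assms in \<open>auto simp: Suc_diff_le\<close>)
  also have "\<dots> = (\<Oplus>j\<in>{..n}. F j (Suc n)) \<oplus> (\<Oplus>j\<in>{..n}. \<Oplus>i\<in>{..n - j}. F j (j + i))"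
    using assms by (intro finsum_addf) auto
  finally show ?case
    using assms by (simp add: Suc a_assoc)
qed

lemma free_nonunital_algebra_simps:
  "carrier (free_nonunital_algebra K X) =
    {f. (\<forall>w. f w \<in> carrier K) \<and> finite {w. f w \<noteq> \<zero>\<^bsub>K\<^esub>} \<and>
        (\<forall>w. f w \<noteq> \<zero>\<^bsub>K\<^esub> \<longrightarrow> w \<noteq> [] \<and> set w \<subseteq> X)}"
  "\<zero>\<^bsub>free_nonunital_algebra K X\<^esub> = (\<lambda>w. \<zero>\<^bsub>K\<^esub>)"
  "f \<oplus>\<^bsub>free_nonunital_algebra K X\<^esub> g = (\<lambda>w. f w \<oplus>\<^bsub>K\<^esub> g w)"
  "f \<otimes>\<^bsub>free_nonunital_algebra K X\<^esub> g =
    (\<lambda>w. \<Oplus>\<^bsub>K\<^esub>i\<in>{..length w}. f (take i w) \<otimes>\<^bsub>K\<^esub> g (drop i w))"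
  "c \<odot>\<^bsub>free_nonunital_algebra K X\<^esub> f = (\<lambda>w. c \<otimes>\<^bsub>K\<^esub> f w)"
  by (simp_all add: free_nonunital_algebra_def)

section \<open>Convolution of coefficient functions on words\<close>

context cring
begin

text \<open>A nonzero coefficient at \<open>w\<close> requires a cut of \<open>w\<close> into words
  from the two supports, so the support of the product consists of concatenations of such
  words.\<close>

lemma free_nonunital_algebra_mult_closed:
  assumes f: "f \<in> carrier (free_nonunital_algebra R X)" and g: "g \<in> carrier (free_nonunital_algebra R X)"
  shows "f \<otimes>\<^bsub>free_nonunital_algebra R X\<^esub> g \<in> carrier (free_nonunital_algebra R X)"
proof -
  let ?p = "f \<otimes>\<^bsub>free_nonunital_algebra R X\<^esub> g"
  have carrier: "f w \<in> carrier R" "g w \<in> carrier R" for w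
    using f g by (auto simp: free_nonunital_algebra_simps)
  have supp: "\<exists>i. f (take i w) \<noteq> \<zero> \<and> g (drop i w) \<noteq> \<zero>" if "?p w \<noteq> \<zero>" for w
  proof (rule ccontr)
    assume "\<not> ?thesis"
    then have "f (take i w) \<otimes> g (drop i w) = \<zero>" for i
      using carrier by (metis l_null r_null)
    with that show False
      by (simp add: free_nonunital_algebra_simps)
  qed
  have "{w. ?p w \<noteq> \<zero>} \<subseteq> (\<lambda>(u, v). u @ v) ` ({u. f u \<noteq> \<zero>} \<times> {v. g v \<noteq> \<zero>})"
  proof
    fix w assume "w \<in> {w. ?p w \<noteq> \<zero>}"
    then obtain i where "f (take i w) \<noteq> \<zero>" "g (drop i w) \<noteq> \<zero>"
      using supp by blast
    then show "w \<in> (\<lambda>(u, v). u @ v) ` ({u. f u \<noteq> \<zero>} \<times> {v. g v \<noteq> \<zero>})"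
      by (intro image_eqI[of _ _ "(take i w, drop i w)"]) auto
  qed
  then have "finite {w. ?p w \<noteq> \<zero>}"
    using f g by (elim finite_subset) (auto simp: free_nonunital_algebra_simps)
  moreover have "w \<noteq> [] \<and> set w \<subseteq> X" if "?p w \<noteq> \<zero>" for w
  proof -
    from supp[OF that] obtain i where "f (take i w) \<noteq> \<zero>" "g (drop i w) \<noteq> \<zero>"
      by blast
    then have "take i w \<noteq> []" "set (take i w) \<subseteq> X" "set (drop i w) \<subseteq> X"
      using f g unfolding free_nonunital_algebra_simps by blast+
    then show ?thesis
      by (metis Un_least append_take_drop_id set_append take_Nil)
  qed
  moreover have "?p w \<in> carrier R" for w
    using carrier by (simp add: free_nonunital_algebra_simps)
  ultimately show ?thesis
    by (simp add: free_nonunital_algebra_simps(1))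
qed

text \<open>Both products sum over the ways to cut \<open>w\<close> into three pieces, at positions
  \<open>j \<le> i\<close>. On the right the second cut is counted from the first, which is the
  reindexing of \<open>finsum_triangle\<close>.\<close>

lemma free_nonunital_algebra_mult_assoc:
  fixes f g k :: "'x list \<Rightarrow> 'a"
  assumes "\<And>w. f w \<in> carrier R" "\<And>w. g w \<in> carrier R" "\<And>w. k w \<in> carrier R"
  shows "(f \<otimes>\<^bsub>free_nonunital_algebra R X\<^esub> g) \<otimes>\<^bsub>free_nonunital_algebra R X\<^esub> k
    = f \<otimes>\<^bsub>free_nonunital_algebra R X\<^esub> (g \<otimes>\<^bsub>free_nonunital_algebra R X\<^esub> k)"
proof
  fix w :: "'x list"
  define F where "F j i = f (take j w) \<otimes> g (drop j (take i w)) \<otimes> k (drop i w)" for j i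
  have "((f \<otimes>\<^bsub>free_nonunital_algebra R X\<^esub> g) \<otimes>\<^bsub>free_nonunital_algebra R X\<^esub> k) w
    = (\<Oplus>i\<in>{..length w}. \<Oplus>j\<in>{..i}. F j i)"
    unfolding free_nonunital_algebra_simps F_def using assms
    by (intro finsum_cong') (auto simp: finsum_ldistr min_def intro!: finsum_cong')
  also have "\<dots> = (\<Oplus>j\<in>{..length w}. \<Oplus>i\<in>{..length w - j}. F j (j + i))"
    by (rule finsum_triangle) (simp add: F_def assms)
  also have "\<dots> = (f \<otimes>\<^bsub>free_nonunital_algebra R X\<^esub> (g \<otimes>\<^bsub>free_nonunital_algebra R X\<^esub> k)) w"
    unfolding free_nonunital_algebra_simps F_def using assms
    by (intro finsum_cong')
      (auto simp: finsum_rdistr m_assoc drop_take add.commute intro!: finsum_cong')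
  finally show "((f \<otimes>\<^bsub>free_nonunital_algebra R X\<^esub> g) \<otimes>\<^bsub>free_nonunital_algebra R X\<^esub> k) w
    = (f \<otimes>\<^bsub>free_nonunital_algebra R X\<^esub> (g \<otimes>\<^bsub>free_nonunital_algebra R X\<^esub> k)) w" .
qed

lemma nonunital_algebra_free: "nonunital_algebra R (free_nonunital_algebra R X)"
proof -
  let ?A = "free_nonunital_algebra R X"
  note simps = free_nonunital_algebra_simps
  have add: "f \<oplus>\<^bsub>?A\<^esub> g \<in> carrier ?A" if fg: "f \<in> carrier ?A" "g \<in> carrier ?A" for f g
  proof -
    have supp: "f w \<noteq> \<zero> \<or> g w \<noteq> \<zero>" if "f w \<oplus> g w \<noteq> \<zero>" for w
      using that by auto
    then have "{w. f w \<oplus> g w \<noteq> \<zero>} \<subseteq> {w. f w \<noteq> \<zero>} \<union> {w. g w \<noteq> \<zero>}"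
      by auto
    moreover have "finite ({w. f w \<noteq> \<zero>} \<union> {w. g w \<noteq> \<zero>})"
      using fg by (simp add: simps)
    ultimately have "finite {w. f w \<oplus> g w \<noteq> \<zero>}"
      by (rule finite_subset)
    then show ?thesis
      using fg supp by (simp add: simps) blast
  qed
  have smult: "c \<odot>\<^bsub>?A\<^esub> f \<in> carrier ?A" if cf: "c \<in> carrier R" "f \<in> carrier ?A" for c f
  proof -
    have supp: "f w \<noteq> \<zero>" if "c \<otimes> f w \<noteq> \<zero>" for w
      using that cf by auto
    then have "{w. c \<otimes> f w \<noteq> \<zero>} \<subseteq> {w. f w \<noteq> \<zero>}"
      by auto
    then have "finite {w. c \<otimes> f w \<noteq> \<zero>}"
      using cf by (elim finite_subset) (simp add: simps)
    then show ?thesis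
      using cf supp by (simp add: simps)
  qed
  have group: "abelian_group ?A"
  proof (rule abelian_groupI)
    fix f assume f: "f \<in> carrier ?A"
    show "\<exists>g\<in>carrier ?A. g \<oplus>\<^bsub>?A\<^esub> f = \<zero>\<^bsub>?A\<^esub>"
    proof (rule bexI)
      \<comment> \<open>The negative is a multiple by minus one, so its finite support follows from
        closure under scalars.\<close>
      show "(\<ominus> \<one>) \<odot>\<^bsub>?A\<^esub> f \<oplus>\<^bsub>?A\<^esub> f = \<zero>\<^bsub>?A\<^esub>"
        using f by (auto simp: simps l_minus l_neg)
      show "(\<ominus> \<one>) \<odot>\<^bsub>?A\<^esub> f \<in> carrier ?A"
        using f by (intro smult) auto
    qed
  next
    fix f g k assume "f \<in> carrier ?A" "g \<in> carrier ?A" "k \<in> carrier ?A"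
    then have carrier: "f w \<in> carrier R" "g w \<in> carrier R" "k w \<in> carrier R" for w
      by (auto simp: simps)
    show "(f \<oplus>\<^bsub>?A\<^esub> g) \<oplus>\<^bsub>?A\<^esub> k = f \<oplus>\<^bsub>?A\<^esub> (g \<oplus>\<^bsub>?A\<^esub> k)"
      using carrier by (simp add: simps a_assoc)
    show "f \<oplus>\<^bsub>?A\<^esub> g = g \<oplus>\<^bsub>?A\<^esub> f"
      using a_comm[OF carrier(1,2)] by (simp add: simps)
  qed (rule add, assumption+, simp_all add: simps)
  have "Module.module R ?A"
    by (rule moduleI[OF is_cring group]; (rule smult, assumption+)?; simp add: simps l_distr r_distr m_assoc)
  moreover have "nonunital_ring_axioms ?A"
  proof
    fix f g k assume fgk: "f \<in> carrier ?A" "g \<in> carrier ?A" "k \<in> carrier ?A"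
    then have carrier: "f w \<in> carrier R" "g w \<in> carrier R" "k w \<in> carrier R" for w
      by (auto simp: simps)
    show "(f \<oplus>\<^bsub>?A\<^esub> g) \<otimes>\<^bsub>?A\<^esub> k = f \<otimes>\<^bsub>?A\<^esub> k \<oplus>\<^bsub>?A\<^esub> g \<otimes>\<^bsub>?A\<^esub> k"
      "k \<otimes>\<^bsub>?A\<^esub> (f \<oplus>\<^bsub>?A\<^esub> g) = k \<otimes>\<^bsub>?A\<^esub> f \<oplus>\<^bsub>?A\<^esub> k \<otimes>\<^bsub>?A\<^esub> g"
      using carrier by (simp_all add: simps l_distr r_distr finsum_addf)
    show "f \<otimes>\<^bsub>?A\<^esub> g \<in> carrier ?A"
      using fgk by (intro free_nonunital_algebra_mult_closed)
    show "(f \<otimes>\<^bsub>?A\<^esub> g) \<otimes>\<^bsub>?A\<^esub> k = f \<otimes>\<^bsub>?A\<^esub> (g \<otimes>\<^bsub>?A\<^esub> k)"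
      using carrier by (intro free_nonunital_algebra_mult_assoc)
  qed
  moreover have "nonunital_algebra_axioms R ?A"
  proof
    fix c f g assume "c \<in> carrier R" "f \<in> carrier ?A" "g \<in> carrier ?A"
    then have carrier: "c \<in> carrier R" "f w \<in> carrier R" "g w \<in> carrier R" for w
      by (auto simp: simps)
    show "(c \<odot>\<^bsub>?A\<^esub> f) \<otimes>\<^bsub>?A\<^esub> g = c \<odot>\<^bsub>?A\<^esub> (f \<otimes>\<^bsub>?A\<^esub> g)"
      "f \<otimes>\<^bsub>?A\<^esub> (c \<odot>\<^bsub>?A\<^esub> g) = c \<odot>\<^bsub>?A\<^esub> (f \<otimes>\<^bsub>?A\<^esub> g)"
      using carrier by (simp_all add: simps finsum_rdistr m_assoc m_lcomm)
  qed
  ultimately show ?thesis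
    by (simp add: nonunital_algebra_def nonunital_ring_def group)
qed

end

section \<open>A countable algebra that is not residually nilpotent\<close>

text \<open>The input is an element \<open>x\<close> all of whose powers are nonzero. Building
  \<open>L\<close> and \<open>B\<close> on the natural numbers makes countability automatic.\<close>

theorem countable_not_residually_nilpotent_equivalent:
  fixes K :: "('k, 'm) ring_scheme" and A :: "('k, 'a, 'n) module_scheme"
  assumes "field K" and "nonunital_algebra K A" and x: "x \<in> carrier A"
    and non_nilpotent: "\<And>n. ((\<lambda>y. y \<otimes>\<^bsub>A\<^esub> x) ^^ n) x \<noteq> \<zero>\<^bsub>A\<^esub>"
  shows "\<exists>(L :: nat ring) (B :: (nat, nat) module).
    field L \<and> nonunital_algebra L B \<and> \<not> residually_nilpotent B \<and> elementarily_equivalent B A"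
proof -

  \<comment> \<open>A countable closed set of sequences\<close>
  interpret K: field K by fact
  interpret A: nonunital_algebra K A by fact
  \<comment> \<open>\<open>p n\<close> is the power of \<open>x\<close> with exponent
    \<open>n + 1\<close>, since the iteration starts at \<open>x\<close>.\<close>
  define p where "p n = ((\<lambda>y. y \<otimes>\<^bsub>A\<^esub> x) ^^ n) x" for n
  have p_Suc: "p (Suc n) = p n \<otimes>\<^bsub>A\<^esub> x" for n
    by (simp add: p_def)
  have p_carrier: "p n \<in> carrier A" for n
    by (induction n) (simp_all add: p_Suc A.m_closed x, simp add: p_def x)
  have p_nonzero: "p n \<noteq> \<zero>\<^bsub>A\<^esub>" for n
    using non_nilpotent by (simp add: p_def)
  obtain K\<^sub>0 where K\<^sub>0: "subfield K\<^sub>0 K" "countable K\<^sub>0"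
    by (rule K.countable_subfield_exists)
  define M where "M = {f :: nat \<Rightarrow> 'a. range f \<subseteq> carrier A}"
  \<comment> \<open>Padding with the zero sequence turns a finite list into a total
    assignment.\<close>
  define nthz where "nthz xs k = (if k < length xs then xs ! k else (\<lambda>_. \<zero>\<^bsub>A\<^esub>))"
    for xs :: "(nat \<Rightarrow> 'a) list" and k
  \<comment> \<open>Assignments are passed as finite lists: there are only countably many of them over a countable
    set, and a formula has finitely many free variables.\<close>
  define skolem where "skolem \<phi> j xs i =
      (let Q = (\<lambda>a. a \<in> carrier A \<and> satisfies A ((\<lambda>k. nthz xs k i)(j := a)) \<phi>)
       in if \<exists>a. Q a then SOME a. Q a else \<zero>\<^bsub>A\<^esub>)" for \<phi> j xs i
  \<comment> \<open>Besides the algebra operations and Skolem functions, the constant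
    \<open>x\<close> and the shifts \<open>p (i - k)\<close> are included: they are the factors of
    the element that will lie in every power. Truncated subtraction affects only indices
    \<open>i < k\<close>.\<close>
  define ops where "ops = {\<lambda>_ _. \<zero>\<^bsub>A\<^esub>, \<lambda>_ _. x,
      \<lambda>xs i. nthz xs 0 i \<oplus>\<^bsub>A\<^esub> nthz xs 1 i, \<lambda>xs i. \<ominus>\<^bsub>A\<^esub> nthz xs 0 i,
      \<lambda>xs i. nthz xs 0 i \<otimes>\<^bsub>A\<^esub> nthz xs 1 i}
    \<union> range (\<lambda>k _ i. p (i - k)) \<union> (\<lambda>c xs i. c \<odot>\<^bsub>A\<^esub> nthz xs 0 i) ` K\<^sub>0
    \<union> (\<lambda>(\<phi>, j). skolem \<phi> j) ` UNIV"
  have nthz_M: "nthz xs k i \<in> carrier A" if "set xs \<subseteq> M" for xs k i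
    using that nth_mem[of k xs] by (auto simp: nthz_def M_def simp del: nth_mem)
  have skolem: "skolem \<phi> j xs i \<in> carrier A" for \<phi> j xs i
    by (auto simp: skolem_def Let_def intro: someI2)
  have ops_countable: "countable ops"
    using K\<^sub>0 by (simp add: ops_def)
  have ops_closed: "f xs \<in> M" if "f \<in> ops" "set xs \<subseteq> M" for f xs
    using that(1) nthz_M[OF that(2)] skolem p_carrier x subfieldE(3)[OF K\<^sub>0(1)]
    by (auto simp: ops_def M_def A.m_closed)
  have "\<exists>D. countable D \<and> D \<subseteq> M \<and> (\<forall>f\<in>ops. \<forall>xs. set xs \<subseteq> D \<longrightarrow> f xs \<in> D)"
    by (rule countable_closure[OF ops_countable]) (rule ops_closed)
  then obtain D where "countable D" and DM: "D \<subseteq> M"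
    and "\<forall>f\<in>ops. \<forall>xs. set xs \<subseteq> D \<longrightarrow> f xs \<in> D"
    by (elim exE conjE)
  then have closed: "f xs \<in> D" if "f \<in> ops" "set xs \<subseteq> D" for f xs
    using that by simp
  have D_carrier: "f i \<in> carrier A" if "f \<in> D" for f i
    using DM that by (auto simp: M_def)
  have D_zero: "(\<lambda>_. \<zero>\<^bsub>A\<^esub>) \<in> D"
    using closed[of "\<lambda>_ _. \<zero>\<^bsub>A\<^esub>" "[]"] by (simp add: ops_def)
  have D_x: "(\<lambda>_. x) \<in> D"
    using closed[of "\<lambda>_ _. x" "[]"] by (simp add: ops_def)
  have D_p: "(\<lambda>i. p (i - k)) \<in> D" for k
    using closed[of "\<lambda>_ i. p (i - k)" "[]"] by (auto simp: ops_def)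
  have D_add: "(\<lambda>i. f i \<oplus>\<^bsub>A\<^esub> g i) \<in> D" if "f \<in> D" "g \<in> D" for f g
    using closed[of "\<lambda>xs i. nthz xs 0 i \<oplus>\<^bsub>A\<^esub> nthz xs 1 i" "[f, g]"] that
    by (simp add: ops_def nthz_def)
  have D_mult: "(\<lambda>i. f i \<otimes>\<^bsub>A\<^esub> g i) \<in> D" if "f \<in> D" "g \<in> D" for f g
    using closed[of "\<lambda>xs i. nthz xs 0 i \<otimes>\<^bsub>A\<^esub> nthz xs 1 i" "[f, g]"] that
    by (simp add: ops_def nthz_def)
  have D_minus: "(\<lambda>i. \<ominus>\<^bsub>A\<^esub> f i) \<in> D" if "f \<in> D" for f
    using closed[of "\<lambda>xs i. \<ominus>\<^bsub>A\<^esub> nthz xs 0 i" "[f]"] that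
    by (simp add: ops_def nthz_def)
  have D_smult: "(\<lambda>i. c \<odot>\<^bsub>A\<^esub> f i) \<in> D" if "c \<in> K\<^sub>0" "f \<in> D" for c f
    using closed[of "\<lambda>xs i. c \<odot>\<^bsub>A\<^esub> nthz xs 0 i" "[f]"] that
    by (auto simp: ops_def nthz_def)
  have D_skolem: "skolem \<phi> j xs \<in> D" if "set xs \<subseteq> D" for \<phi> j xs
    using closed[of "skolem \<phi> j" xs] that by (force simp: ops_def)

  \<comment> \<open>The quotient by an ultrafilter, encoded on the naturals\<close>
  obtain U :: "nat filter" where U: "U \<le> sequentially" "U \<noteq> bot"
    "\<And>P. eventually P U \<or> eventually (\<lambda>i. \<not> P i) U"
    using ultrafilter_below[OF sequentially_bot] by blast
  \<comment> \<open>A class is numbered through a chosen representative in the countable set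
    \<open>D\<close>. Sequences that agree eventually define the same predicate under
    \<open>SOME\<close>, hence get the same number.\<close>
  define h where "h f = to_nat_on D (SOME g. g \<in> D \<and> (\<forall>\<^sub>F i in U. f i = g i))" for f
  have h_eq_iff: "h f = h g \<longleftrightarrow> (\<forall>\<^sub>F i in U. f i = g i)" if "f \<in> D" "g \<in> D" for f g
  proof
    let ?r = "\<lambda>f. SOME g. g \<in> D \<and> (\<forall>\<^sub>F i in U. f i = g i)"
    have r: "?r f \<in> D \<and> (\<forall>\<^sub>F i in U. f i = ?r f i)" if "f \<in> D" for f
      by (rule someI[of _ f]) (use that in simp)
    assume "h f = h g"
    then have "?r f = ?r g"
      using r that \<open>countable D\<close> by (simp add: h_def)
    then have "\<forall>\<^sub>F i in U. f i = ?r g i" "\<forall>\<^sub>F i in U. g i = ?r g i"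
      using r[OF that(1)] r[OF that(2)] by simp_all
    then show "\<forall>\<^sub>F i in U. f i = g i"
      by eventually_elim simp
  next
    assume fg: "\<forall>\<^sub>F i in U. f i = g i"
    have "(\<forall>\<^sub>F i in U. f i = k i) \<longleftrightarrow> (\<forall>\<^sub>F i in U. g i = k i)" for k
      by (rule eventually_subst) (use fg in eventually_elim, simp)
    then show "h f = h g"
      by (simp add: h_def)
  qed

  \<comment> \<open>\<open>r\<close> picks a sequence for each number; \<open>r (h f)\<close> agrees
    with \<open>f\<close> only eventually along \<open>U\<close>, so the operations defined through
    \<open>r\<close> must be checked to be well defined.\<close>
  define r where "r = inv_into D h"
  have r: "r (h f) \<in> D" "\<forall>\<^sub>F i in U. r (h f) i = f i" if "f \<in> D" for f
  proof -
    show "r (h f) \<in> D"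
      using that by (simp add: r_def inv_into_into)
    then show "\<forall>\<^sub>F i in U. r (h f) i = f i"
      using that by (subst h_eq_iff[symmetric]) (simp_all add: r_def f_inv_into_f)
  qed
  \<comment> \<open>\<open>L\<close> is the countable subfield transported to natural numbers along
    the injection \<kappa>.\<close>
  define K\<^sub>1 where "K\<^sub>1 = K\<lparr>carrier := K\<^sub>0\<rparr>"
  define \<kappa> where "\<kappa> = to_nat_on K\<^sub>0"
  define L where "L = image_ring \<kappa> K\<^sub>1"
  interpret K\<^sub>1: field K\<^sub>1
    unfolding K\<^sub>1_def by (rule K.subfield_iff(2)) (fact K\<^sub>0)
  have \<kappa>_inj: "inj_on \<kappa> (carrier K\<^sub>1)"
    using K\<^sub>0 by (simp add: \<kappa>_def K\<^sub>1_def inj_on_to_nat_on)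
  then interpret L: field L
    unfolding L_def by (rule K\<^sub>1.inj_imp_image_ring_is_field)
  \<comment> \<open>The inverse of this renaming, followed by the inclusion of the subfield, is the
    homomorphism through which \<open>L\<close> acts.\<close>
  define \<sigma> where "\<sigma> = inv_into (carrier K\<^sub>1) \<kappa>"
  have "\<sigma> \<in> ring_iso L K\<^sub>1"
    unfolding \<sigma>_def L_def
    by (rule ring_iso_set_sym[OF K\<^sub>1.is_ring inj_imp_image_ring_iso[OF \<kappa>_inj]])
  then have \<sigma>_closed: "\<sigma> c \<in> K\<^sub>0" if "c \<in> carrier L" for c
    using ring_hom_closed[of \<sigma> L K\<^sub>1 c] that by (simp add: ring_iso_def K\<^sub>1_def)
  have \<sigma>: "\<sigma> \<in> ring_hom L K"
    using \<open>\<sigma> \<in> ring_iso L K\<^sub>1\<close> subfieldE(3)[OF K\<^sub>0(1)]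
    by (auto simp: ring_iso_def ring_hom_def K\<^sub>1_def)
  define B :: "(nat, nat) module" where
    "B = \<lparr>carrier = h ` D, mult = (\<lambda>a b. h (\<lambda>i. r a i \<otimes>\<^bsub>A\<^esub> r b i)), one = undefined,
      zero = h (\<lambda>_. \<zero>\<^bsub>A\<^esub>), add = (\<lambda>a b. h (\<lambda>i. r a i \<oplus>\<^bsub>A\<^esub> r b i)),
      smult = (\<lambda>c b. h (\<lambda>i. \<sigma> c \<odot>\<^bsub>A\<^esub> r b i))\<rparr>"
  have B_smult: "c \<odot>\<^bsub>B\<^esub> h f = h (\<lambda>i. \<sigma> c \<odot>\<^bsub>A\<^esub> f i)" if "c \<in> carrier L" "f \<in> D" for c f
  proof -
    have "\<forall>\<^sub>F i in U. \<sigma> c \<odot>\<^bsub>A\<^esub> r (h f) i = \<sigma> c \<odot>\<^bsub>A\<^esub> f i"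
      using r(2)[OF that(2)] by eventually_elim simp
    then show ?thesis
      using that by (simp add: B_def h_eq_iff r D_smult \<sigma>_closed)
  qed
  interpret ultrapower_image A U D h B
  proof
    fix f g assume fg: "f \<in> D" "g \<in> D"
    have "\<forall>\<^sub>F i in U. r (h f) i \<oplus>\<^bsub>A\<^esub> r (h g) i = f i \<oplus>\<^bsub>A\<^esub> g i"
      using r(2)[OF fg(1)] r(2)[OF fg(2)] by eventually_elim simp
    then show "h f \<oplus>\<^bsub>B\<^esub> h g = h (\<lambda>i. f i \<oplus>\<^bsub>A\<^esub> g i)"
      using fg by (simp add: B_def h_eq_iff r D_add)
    have "\<forall>\<^sub>F i in U. r (h f) i \<otimes>\<^bsub>A\<^esub> r (h g) i = f i \<otimes>\<^bsub>A\<^esub> g i"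
      using r(2)[OF fg(1)] r(2)[OF fg(2)] by eventually_elim simp
    then show "h f \<otimes>\<^bsub>B\<^esub> h g = h (\<lambda>i. f i \<otimes>\<^bsub>A\<^esub> g i)"
      using fg by (simp add: B_def h_eq_iff r D_mult)
  qed (simp_all add: U D_carrier D_zero D_add D_minus D_mult h_eq_iff, simp_all add: B_def)

  have "nonunital_algebra L B"
    by (rule nonunital_algebra_ultrapower_image[OF ultrapower_image_axioms \<open>nonunital_algebra K A\<close> L.is_cring \<sigma>])
      (simp_all add: D_smult \<sigma>_closed B_smult)

  \<comment> \<open>Elementary equivalence by Los's argument\<close>
  moreover have "elementarily_equivalent B A"
  proof -
    have witness: "\<exists>w\<in>D. \<forall>i. (\<exists>a\<in>carrier A. satisfies A ((\<lambda>k. e k i)(j := a)) \<phi>)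
        \<longrightarrow> satisfies A ((\<lambda>k. e k i)(j := w i)) \<phi>"
      if e: "\<forall>k. e k \<in> D" for \<phi> j e
    proof -
      obtain m where m: "\<And>k. k \<in> free_vars \<phi> \<Longrightarrow> k < m"
        using finite_free_vars[of \<phi>] by (auto simp: finite_nat_set_iff_bounded)
      \<comment> \<open>All free variables of \<phi> lie below \<open>m\<close>, so this finite list
        carries as much of the assignment as \<phi> can see.\<close>
      let ?xs = "map e [0..<m]"
      have "satisfies A ((\<lambda>k. nthz ?xs k i)(j := a)) \<phi> \<longleftrightarrow> satisfies A ((\<lambda>k. e k i)(j := a)) \<phi>" for i a
        using m by (intro satisfies_cong) (simp add: nthz_def)
      then have "skolem \<phi> j ?xs i = (let Q = (\<lambda>a. a \<in> carrier A \<and> satisfies A ((\<lambda>k. e k i)(j := a)) \<phi>)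
        in if \<exists>a. Q a then SOME a. Q a else \<zero>\<^bsub>A\<^esub>)" for i
        by (simp add: skolem_def)
      then have "satisfies A ((\<lambda>k. e k i)(j := skolem \<phi> j ?xs i)) \<phi>"
        if "\<exists>a\<in>carrier A. satisfies A ((\<lambda>k. e k i)(j := a)) \<phi>" for i
        using that someI_ex[of "\<lambda>a. a \<in> carrier A \<and> satisfies A ((\<lambda>k. e k i)(j := a)) \<phi>"]
        by (auto simp: Let_def)
      moreover have "skolem \<phi> j ?xs \<in> D"
        using e by (intro D_skolem) auto
      ultimately show ?thesis by blast
    qed
    show ?thesis
      unfolding elementarily_equivalent_def
    proof (intro allI impI)
      fix \<phi> assume \<phi>: "is_sentence \<phi>"
      have "models B \<phi> \<longleftrightarrow> satisfies B (\<lambda>_. h (\<lambda>_. \<zero>\<^bsub>A\<^esub>)) \<phi>"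
        using \<phi> by (rule models_sentence_iff) (auto simp: B_carrier D_zero)
      also have "\<dots> \<longleftrightarrow> (\<forall>\<^sub>F i in U. satisfies A (\<lambda>_. \<zero>\<^bsub>A\<^esub>) \<phi>)"
        by (rule satisfies_iff_eventually) (use witness D_zero in blast)+
      \<comment> \<open>The condition no longer depends on \<open>i\<close>, and a constant
        condition is eventual for a proper filter exactly when it is true.\<close>
      also have "\<dots> \<longleftrightarrow> models A \<phi>"
        using \<phi> U(2) by (subst models_sentence_iff[where e = "\<lambda>_. \<zero>\<^bsub>A\<^esub>"]) (auto simp: eventually_const_iff)
      finally show "models B \<phi> \<longleftrightarrow> models A \<phi>" .
    qed
  qed

  \<comment> \<open>A nonzero element in every power\<close>
  moreover have "\<not> residually_nilpotent B"
  proof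
    assume "residually_nilpotent B"
    \<comment> \<open>\<open>?b 0\<close> is the class of the sequence of all powers of
      \<open>x\<close>; \<open>?b k\<close> is its shift by \<open>k\<close>, left after splitting
      off \<open>k\<close> factors \<open>x\<close>.\<close>
    let ?b = "\<lambda>k. h (\<lambda>i. p (i - k))"
    have step: "?b (Suc k) \<otimes>\<^bsub>B\<^esub> h (\<lambda>_. x) = ?b k" for k
    proof -
      have "\<forall>\<^sub>F i in U. p (i - Suc k) \<otimes>\<^bsub>A\<^esub> x = p (i - k)"
      \<comment> \<open>Since \<open>U\<close> is below \<open>sequentially\<close>, it suffices to
        treat large \<open>i\<close>. From \<open>Suc k\<close> on, the subtraction is not
        truncated.\<close>
      proof (rule filter_leD[OF U(1)])
        show "\<forall>\<^sub>F i in sequentially. p (i - Suc k) \<otimes>\<^bsub>A\<^esub> x = p (i - k)"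
          using eventually_ge_at_top[of "Suc k"]
        proof eventually_elim
          case (elim i)
          then have "i - k = Suc (i - Suc k)" by simp
          then show ?case by (simp add: p_Suc)
        qed
      qed
      then show ?thesis
        by (simp add: B_mult D_x D_p D_mult h_eq_iff)
    qed
    have prod: "foldl (mult B) (?b k) (replicate k (h (\<lambda>_. x))) = ?b 0" for k
      by (induction k) (simp_all add: step)
    have "?b 0 \<in> ring_power B n" if "n \<ge> 1" for n
    proof -
      from that obtain k where k: "n = Suc k"
        by (cases n) auto
      \<comment> \<open>The first factor \<open>?b k\<close> and \<open>k\<close> copies of
        \<open>x\<close> make \<open>k + 1 = n\<close> factors.\<close>
      have "\<exists>a as. ?b 0 = foldl (mult B) a as \<and> a \<in> carrier B \<and> set as \<subseteq> carrier B \<and> Suc (length as) = n"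
        by (intro exI[of _ "?b k"] exI[of _ "replicate k (h (\<lambda>_. x))"])
          (auto simp: prod[of k] k B_carrier D_p D_x)
      then show ?thesis
        unfolding ring_power_def products_of_def by (intro generate.incl) blast
    qed
    then have "?b 0 = \<zero>\<^bsub>B\<^esub>"
      using \<open>residually_nilpotent B\<close> unfolding residually_nilpotent_def by blast
    \<comment> \<open>Equality with zero would make \<open>p i\<close> vanish for eventually all
      \<open>i\<close>, whereas no \<open>p i\<close> is zero.\<close>
    then have "\<forall>\<^sub>F i in U. False"
      using D_p[of 0] D_zero p_nonzero by (simp add: B_zero h_eq_iff)
    with U(2) show False
      by (simp add: trivial_limit_def)
  qed
  ultimately show ?thesis
    using L.field_axioms by blast
qed

text \<open>The powers of a generator are the monomials in one letter: the only cut with a nonzero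
  contribution separates the last letter.\<close>

lemma (in field) free_nonunital_algebra_power:
  assumes "a \<in> X"
  defines "x \<equiv> (\<lambda>w. if w = [a] then \<one> else \<zero>)"
  shows "((\<lambda>y. y \<otimes>\<^bsub>free_nonunital_algebra R X\<^esub> x) ^^ n) x
    = (\<lambda>w. if w = replicate (Suc n) a then \<one> else \<zero>)"
proof (induction n)
  case (Suc n)
  let ?y = "\<lambda>w. if w = replicate (Suc n) a then \<one> else \<zero>"
  have "(\<Oplus>i\<in>{..length w}. ?y (take i w) \<otimes> x (drop i w))
      = (if w = replicate (Suc (Suc n)) a then \<one> else \<zero>)" (is "_ = ?z") for w
  proof -
    have split: "take i w = replicate (Suc n) a \<and> drop i w = [a]
      \<longleftrightarrow> i = Suc n \<and> w = replicate (Suc (Suc n)) a" if "i \<le> length w" for i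
    proof
      assume eq: "take i w = replicate (Suc n) a \<and> drop i w = [a]"
      then have "length (take i w) = Suc n"
        by simp
      then have "i = Suc n"
        using that by simp
      moreover have "w = replicate (Suc n) a @ [a]"
        using eq append_take_drop_id[of i w] by metis
      ultimately show "i = Suc n \<and> w = replicate (Suc (Suc n)) a"
        by (simp add: replicate_append_same)
    qed (simp add: replicate_append_same[symmetric])
    have "?y (take i w) \<otimes> x (drop i w) = (if Suc n = i then ?z else \<zero>)" if "i \<le> length w" for i
    proof -
      have "?y (take i w) \<otimes> x (drop i w)
        = (if take i w = replicate (Suc n) a \<and> drop i w = [a] then \<one> else \<zero>)"
        by (simp add: x_def del: replicate_Suc)
      then show ?thesis
        unfolding split[OF that] by auto
    qed
    then have "(\<Oplus>i\<in>{..length w}. ?y (take i w) \<otimes> x (drop i w))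
      = (\<Oplus>i\<in>{..length w}. if Suc n = i then ?z else \<zero>)"
      by (intro finsum_cong') auto
    also have "\<dots> = ?z"
    \<comment> \<open>If the cut position exceeds the length of \<open>w\<close>, then
      \<open>w\<close> is too short to be the monomial and both sides vanish.\<close>
    proof (cases "Suc n \<le> length w")
      case True
      then show ?thesis
        by (subst add.finprod_singleton) auto
    next
      case False
      then have "?z = \<zero>"
        by auto
      then show ?thesis
        unfolding \<open>?z = \<zero>\<close> by simp
    qed
    finally show ?thesis .
  qed
  then show ?case
    using Suc by (simp add: free_nonunital_algebra_simps(4) fun_eq_iff)
qed (simp add: x_def)

theorem theorem9p9:
  fixes K :: "('k, 'm) ring_scheme" and X :: "'x set"
  assumes "field K" and "finite X" and "X \<noteq> {}"
  shows "\<exists>(L :: nat ring) (B :: (nat, nat) module).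
    field L \<and> nonunital_algebra L B \<and> countable (carrier B) \<and>
    \<not> residually_nilpotent B \<and>
    elementarily_equivalent B (free_nonunital_algebra K X)"
proof -
  interpret field K by fact
  let ?A = "free_nonunital_algebra K X"
  from \<open>X \<noteq> {}\<close> obtain a where a: "a \<in> X" by blast
  \<comment> \<open>The generator \<open>a\<close> is the indicator of the one-letter word; its
    powers are indicators of words and hence nonzero.\<close>
  let ?x = "\<lambda>w. if w = [a] then \<one>\<^bsub>K\<^esub> else \<zero>\<^bsub>K\<^esub>"
  have "?x \<in> carrier ?A"
    using a by (simp add: free_nonunital_algebra_simps)
  moreover have "((\<lambda>y. y \<otimes>\<^bsub>?A\<^esub> ?x) ^^ n) ?x \<noteq> \<zero>\<^bsub>?A\<^esub>" for n
    unfolding free_nonunital_algebra_power[OF a]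
    by (auto simp: free_nonunital_algebra_simps fun_eq_iff)
  ultimately show ?thesis
    using countable_not_residually_nilpotent_equivalent[OF \<open>field K\<close> nonunital_algebra_free]
    by (metis countableI_type)
qed

end
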